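(* Let $M$ be a measurable space with $\sigma$-algebra $\mathcal{B}$, let $\xi\in\mathbb{Z}^+$ and $\Xi=\{1,\ldots,\xi\}$, and let $(Y,S)$ and $(Y_i,S_i)$, $i\in\mathbb{Z}^+$, be $M\times\Xi$-valued random elements on a probability space $(\Omega,\mathcal{F},P)$. For $n\in\mathbb{Z}^+$ and $s\in\Xi$ put $N_n^s=\sum_{i=1}^n I\{S_i=s\}$. Assume: (i) the pairs $(Y_i,S_i)$, $i\in\mathbb{Z}^+$, are independent; (ii) for every $i\in\mathbb{Z}^+$ and every $s\in\Xi$ with $P(S_i=s)P(S=s)>0$, the conditional distribution of $Y_i$ given $S_i=s$ equals the conditional distribution of $Y$ given $S=s$; (iii) $\lim_{n\to\infty}N_n^s=\infty$ almost surely for every $s\in\Xi$; (iv) $P(S=s)>0$ for every $s\in\Xi$. For $s\in\Xi$ and $j\in\mathbb{Z}^+$ let $K_j^s$, $Y_{(j)}^s=Y_{K_j^s}$ and $S_{(j)}^s=S_{K_j^s}$ be as defined in the context ($Y_{(j)}^s$ is the variable of interest for the $j$th sampled unit from group $s$). Then: (a) For all $s\in\Xi$ and $j\in\mathbb{Z}^+$, the maps $K_j^s$, $Y_{(j)}^s$ and $S_{(j)}^s$ are measurable. (b) For all $s\in\Xi$ and $n\in\mathbb{Z}^+$, the random elements $N_n^s,Y_{(1)}^s,Y_{(2)}^s,\ldots$ are (mutually) independent, and for every $j\in\mathbb{Z}^+$ the distribution of $Y_{(j)}^s$ is the conditional distribution of $Y$ given $S=s$. (c) For all $m_1,\ldots,m_\xi\in\mathbb{Z}^+$,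 the $\xi$ random vectors $(Y_{(1)}^s,\ldots,Y_{(m_s)}^s)$, $s\in\Xi$, are independent.
   Context: $I\{\cdot\}$ denotes an indicator function. $\Xi$ and $\{0\}\cup\mathbb{Z}^+$ carry their discrete $\sigma$-algebras, and Cartesian products carry product $\sigma$-algebras. For $s\in\Xi$ let $\Omega^s=\{\omega\in\Omega:\lim_{n\to\infty}N_n^s(\omega)=\infty\}$. For $s\in\Xi$ and $j\in\mathbb{Z}^+$ define $K_j^s:\Omega\to\mathbb{Z}^+$ as follows: on $\Omega^s$, $K_j^s$ is the smallest $k\in\mathbb{Z}^+$ with $\sum_{i=1}^k I\{S_i=s\}=j$ (i.e. the $j$th positive integer $i$ for which $S_i=s$); on the complement $(\Omega^s)^c$, $K_j^s=1$. Then $Y_{(j)}^s(\omega)=Y_{K_j^s(\omega)}(\omega)$ and $S_{(j)}^s(\omega)=S_{K_j^s(\omega)}(\omega)$. *)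

theory Defs
  imports "HOL-Probability.Probability"
begin

text \<open>
  Positive integers are natural numbers \<open>\<ge> 1\<close>: a sequence \<open>X\<^sub>i\<close> with \<open>i\<close> a positive integer is a
  function on \<open>nat\<close> whose value at \<open>0\<close> is never used.
\<close>

definition group_count :: "(nat \<Rightarrow> 'a \<Rightarrow> nat) \<Rightarrow> nat \<Rightarrow> nat \<Rightarrow> 'a \<Rightarrow> nat" where
  "group_count S s n \<omega> = (\<Sum>i=1..n. of_bool (S i \<omega> = s))"

definition sampled_forever :: "(nat \<Rightarrow> 'a \<Rightarrow> nat) \<Rightarrow> nat \<Rightarrow> 'a \<Rightarrow> bool" where
  "sampled_forever S s \<omega> \<longleftrightarrow> filterlim (\<lambda>n. group_count S s n \<omega>) at_top sequentially"

definition group_index :: "(nat \<Rightarrow> 'a \<Rightarrow> nat) \<Rightarrow> nat \<Rightarrow> nat \<Rightarrow> 'a \<Rightarrow> nat" where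
  "group_index S s j \<omega> =
     (if sampled_forever S s \<omega> then (LEAST k. 1 \<le> k \<and> group_count S s k \<omega> = j) else 1)"

text \<open>
  \<open>X\<close> at the time of the \<open>j\<close>th unit sampled from group \<open>s\<close>; applied below both with \<open>X\<close> the
  variables of interest and with \<open>X = S\<close>.
\<close>

definition group_sample ::
    "(nat \<Rightarrow> 'a \<Rightarrow> nat) \<Rightarrow> (nat \<Rightarrow> 'a \<Rightarrow> 'b) \<Rightarrow> nat \<Rightarrow> nat \<Rightarrow> 'a \<Rightarrow> 'b" where
  "group_sample S X s j \<omega> = X (group_index S s j \<omega>) \<omega>"

text \<open>Meaningful only if the conditioning event \<open>E\<close> has positive probability.\<close>

definition cond_distr :: "'a measure \<Rightarrow> 'a set \<Rightarrow> 'b measure \<Rightarrow> ('a \<Rightarrow> 'b) \<Rightarrow> 'b measure" where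
  "cond_distr P E M X = distr (uniform_measure P E) M X"

text \<open>
  The library's \<open>indep_vars\<close> needs all variables to have values in one HOL type. For variables
  with values in different types we use what it unfolds to (\<open>indep_vars_def2\<close>): measurability of
  each variable, together with \<open>indep_sets\<close> of the following families.
\<close>

definition preimage_events :: "'a measure \<Rightarrow> 'b measure \<Rightarrow> ('a \<Rightarrow> 'b) \<Rightarrow> 'a set set" where
  "preimage_events P M X = {X -` A \<inter> space P | A. A \<in> sets M}"

end

theory Submission
  imports Defs
begin

text \<open>
  Let \<open>Q\<^sub>s\<close> be the conditional distribution of \<open>Y\<close> given \<open>S = s\<close>. Almost surely the \<open>Y\<^sub>(\<^sub>j\<^sub>)\<^sup>s\<close> are a
  relabelling of the \<open>Y\<^sub>i\<close>: unit \<open>i\<close> gets the label \<open>(S\<^sub>i, number of k \<le> i with S\<^sub>k = S\<^sub>i)\<close>. Given the first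
  \<open>n\<close> groups \<open>S\<^sub>1, \<dots>, S\<^sub>n\<close>, the labels of the first \<open>n\<close> units are fixed, and \<open>Y\<^sub>1, \<dots>, Y\<^sub>n\<close> are independent
  with \<open>Y\<^sub>i\<close> distributed as \<open>Q\<close> at \<open>S\<^sub>i\<close>. If in addition every group has at least \<open>m\<close> members among these
  units, then \<open>Y\<^sub>(\<^sub>j\<^sub>)\<^sup>s\<close>, for \<open>j \<le> m\<close>, are therefore conditionally independent with laws \<open>Q\<^sub>s\<close>, which do
  not depend on the groups conditioned on. Letting \<open>n\<close> tend to infinity removes the extra condition.
\<close>

section \<open>Counts and sampling times along a single sequence of groups\<close>

lemma group_count_0 [simp]: "group_count S s 0 \<omega> = 0"
  by (simp add: group_count_def)

lemma group_count_Suc [simp]: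
  "group_count S s (Suc n) \<omega> = group_count S s n \<omega> + of_bool (S (Suc n) \<omega> = s)"
  by (simp add: group_count_def)

lemma group_count_mono: "m \<le> n \<Longrightarrow> group_count S s m \<omega> \<le> group_count S s n \<omega>"
  by (rule lift_Suc_mono_le[of "\<lambda>n. group_count S s n \<omega>"]) auto

lemma group_count_less:
  assumes "k < i" "S i \<omega> = s"
  shows "group_count S s k \<omega> < group_count S s i \<omega>"
proof -
  obtain i' where i: "i = Suc i'" using assms by (cases i) auto
  then have "group_count S s k \<omega> \<le> group_count S s i' \<omega>"
    using assms by (intro group_count_mono) auto
  then show ?thesis using assms i by simp
qed

lemma sampled_foreverD:
  assumes "sampled_forever S s \<omega>"
  obtains n where "c \<le> group_count S s n \<omega>"
  using assms unfolding sampled_forever_def filterlim_at_top eventually_sequentially by blast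

text \<open>The count grows by at most one per unit, so the first time it is at least
  \<open>j\<close> it equals \<open>j\<close>; hence the \<open>LEAST\<close> in
  \<open>group_index\<close> is attained. Minimality puts that unit in group \<open>s\<close>:
  otherwise the preceding unit would already have count \<open>j\<close>.\<close>

lemma group_index_works:
  assumes "sampled_forever S s \<omega>" "1 \<le> j"
  shows "1 \<le> group_index S s j \<omega>" "group_count S s (group_index S s j \<omega>) \<omega> = j"
    "S (group_index S s j \<omega>) \<omega> = s"
proof -
  obtain n where n: "j \<le> group_count S s n \<omega>" using assms(1) by (rule sampled_foreverD)
  let ?k = "LEAST k. j \<le> group_count S s k \<omega>"
  have le: "j \<le> group_count S s ?k \<omega>" using n by (rule LeastI)
  then obtain k' where k': "?k = Suc k'"
    using assms(2) by (cases ?k) auto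
  have "\<not> j \<le> group_count S s k' \<omega>"
    using not_less_Least[of k' "\<lambda>k. j \<le> group_count S s k \<omega>"] k' by simp
  then have "1 \<le> ?k \<and> group_count S s ?k \<omega> = j"
    using le unfolding k' by (cases "S (Suc k') \<omega> = s") auto
  then have *: "1 \<le> group_index S s j \<omega> \<and> group_count S s (group_index S s j \<omega>) \<omega> = j"
    unfolding group_index_def using assms(1) by (simp only: if_True) (rule LeastI)
  then show "1 \<le> group_index S s j \<omega>" "group_count S s (group_index S s j \<omega>) \<omega> = j" by auto
  show "S (group_index S s j \<omega>) \<omega> = s"
  proof (rule ccontr)
    assume neq: "S (group_index S s j \<omega>) \<omega> \<noteq> s"
    obtain i where i: "group_index S s j \<omega> = Suc i" using * by (cases "group_index S s j \<omega>") auto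
    then have "group_count S s i \<omega> = j" using * neq by simp
    \<comment> \<open>The count at \<open>0\<close> is \<open>0\<close> while
      \<open>j \<ge> 1\<close>, so the preceding index is again positive and competes in the
      \<open>LEAST\<close>.\<close>
    moreover then have "1 \<le> i" using assms(2) by (cases i) auto
    ultimately have "group_index S s j \<omega> \<le> i"
      unfolding group_index_def using assms(1) by (simp add: Least_le)
    then show False using i by simp
  qed
qed

text \<open>Unit \<open>i\<close> itself is counted, so all earlier counts are strictly smaller.
  Together with \<open>group_index_works\<close> this makes units and labels correspond one to one
  on paths that sample every group forever.\<close>

lemma group_index_group_count:
  assumes "sampled_forever S s \<omega>" "1 \<le> i" "S i \<omega> = s"
  shows "group_index S s (group_count S s i \<omega>) \<omega> = i"
proof -
  have "(LEAST k. 1 \<le> k \<and> group_count S s k \<omega> = group_count S s i \<omega>) = i"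
  proof (rule Least_equality)
    fix k assume "1 \<le> k \<and> group_count S s k \<omega> = group_count S s i \<omega>"
    then show "i \<le> k" using group_count_less[of k i S \<omega> s] assms(3) by (cases "k < i") auto
  qed (use assms in auto)
  then show ?thesis using assms(1) by (simp add: group_index_def)
qed

text \<open>The counts of a deterministic sequence of groups \<open>t\<close>, which plays the role of \<open>\<omega>\<close>.\<close>

abbreviation label_count :: "nat \<Rightarrow> nat \<Rightarrow> (nat \<Rightarrow> nat) \<Rightarrow> nat" where
  "label_count \<equiv> group_count (\<lambda>i t. t i)"

lemma group_count_eq_label_count: "group_count S s n \<omega> = label_count s n (\<lambda>i. S i \<omega>)"
  by (simp add: group_count_def)

lemma label_count_cong:
  "(\<And>i. i \<in> {1..n} \<Longrightarrow> t i = t' i) \<Longrightarrow> label_count s n t = label_count s n t'"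
  unfolding group_count_def by (intro sum.cong) auto

text \<open>Among the first \<open>n\<close> units the members of group \<open>s\<close> carry the
  labels \<open>(s, 1)\<close>, ..., \<open>(s, label_count s n t)\<close>, each once, so a product
  over units regroups into one over labels.\<close>

lemma prod_label_count:
  fixes q :: "nat \<Rightarrow> nat \<Rightarrow> 'c::comm_monoid_mult"
  assumes "finite G" "\<And>i. i \<in> {1..n} \<Longrightarrow> t i \<in> G"
  shows "(\<Prod>i=1..n. q (t i) (label_count (t i) i t)) = (\<Prod>s\<in>G. \<Prod>j=1..label_count s n t. q s j)"
  using assms(2)
proof (induction n)
  case (Suc n)
  \<comment> \<open>Unit \<open>Suc n\<close> adds one factor, in its own group only, and its index
    there is the new count.\<close>
  have "(\<Prod>s\<in>G. \<Prod>j=1..label_count s (Suc n) t. q s j) =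
    (\<Prod>s\<in>G. (\<Prod>j=1..label_count s n t. q s j) *
        (if t (Suc n) = s then q s (label_count s (Suc n) t) else 1))"
    by (intro prod.cong) auto
  also have "\<dots> = (\<Prod>i=1..n. q (t i) (label_count (t i) i t)) *
      q (t (Suc n)) (label_count (t (Suc n)) (Suc n) t)"
    using Suc assms(1) by (simp add: prod.distrib)
  finally show ?case by simp
qed simp

section \<open>The probabilistic setting and measurability\<close>

text \<open>\<open>Q s\<close> stands for the conditional law of the variable of interest in group
  \<open>s\<close>. The product form of \<open>cond\<close> makes sense even if unit
  \<open>i\<close> falls in group \<open>s\<close> with probability zero.\<close>

locale group_sampling = prob_space P
  for P :: "'a measure" +
  fixes M :: "'b measure" and G :: "nat set" and Q :: "nat \<Rightarrow> 'b measure"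
    and Ys :: "nat \<Rightarrow> 'a \<Rightarrow> 'b" and Ss :: "nat \<Rightarrow> 'a \<Rightarrow> nat"
  assumes finite_G: "finite G"
    and indep: "indep_vars (\<lambda>i. M \<Otimes>\<^sub>M count_space G) (\<lambda>i \<omega>. (Ys i \<omega>, Ss i \<omega>)) {1..}"
    and cond: "\<And>i s C. 1 \<le> i \<Longrightarrow> s \<in> G \<Longrightarrow> C \<in> sets M \<Longrightarrow>
      \<P>(\<omega> in P. Ss i \<omega> = s \<and> Ys i \<omega> \<in> C) = \<P>(\<omega> in P. Ss i \<omega> = s) * measure (Q s) C"
    and AE_sampled: "\<And>s. s \<in> G \<Longrightarrow> AE \<omega> in P. sampled_forever Ss s \<omega>"
    and prob_space_Q: "\<And>s. s \<in> G \<Longrightarrow> prob_space (Q s)"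
    and sets_Q: "\<And>s. s \<in> G \<Longrightarrow> sets (Q s) = sets M"
begin

lemma measurable_pair [measurable]:
  "1 \<le> i \<Longrightarrow> (\<lambda>\<omega>. (Ys i \<omega>, Ss i \<omega>)) \<in> measurable P (M \<Otimes>\<^sub>M count_space G)"
  using indep by (simp add: indep_vars_def)

lemma measurable_Ys: "1 \<le> i \<Longrightarrow> Ys i \<in> measurable P M"
  using measurable_compose[OF measurable_pair measurable_fst] by simp

lemma measurable_Ss: "1 \<le> i \<Longrightarrow> Ss i \<in> measurable P (count_space G)"
  using measurable_compose[OF measurable_pair measurable_snd] by simp

lemma Ss_in: "1 \<le> i \<Longrightarrow> \<omega> \<in> space P \<Longrightarrow> Ss i \<omega> \<in> G"
  using measurable_space[OF measurable_Ss] by simp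

lemma measurable_Ss_eq: "1 \<le> i \<Longrightarrow> Measurable.pred P (\<lambda>\<omega>. Ss i \<omega> = s)"
  by (rule measurable_compose[OF measurable_Ss]) simp_all

lemma measurable_group_count [measurable]:
  "group_count Ss s n \<in> measurable P (count_space UNIV)"
proof (induction n)
  case 0
  then show ?case by (simp add: group_count_def[abs_def])
next
  case (Suc n)
  have "Ss (Suc n) \<in> measurable P (count_space UNIV)"
    by (rule measurable_compose[OF measurable_Ss, of _ "\<lambda>s. s"]) simp_all
  with Suc show ?case unfolding group_count_Suc[abs_def] of_bool_def by measurable
qed

lemma measurable_sampled_forever [measurable]: "Measurable.pred P (sampled_forever Ss s)"
  unfolding sampled_forever_def[abs_def] filterlim_at_top eventually_sequentially by measurable

lemma measurable_group_index [measurable]: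
  assumes "1 \<le> j"
  shows "group_index Ss s j \<in> measurable P (count_space {1..})"
proof -
  have "group_index Ss s j \<in> measurable P (count_space UNIV)"
    unfolding group_index_def[abs_def] by measurable
  \<comment> \<open>The default value 1 outside \<open>sampled_forever\<close> keeps the index
    positive on every path.\<close>
  moreover have "1 \<le> group_index Ss s j \<omega>" for \<omega>
  proof (cases "sampled_forever Ss s \<omega>")
    case True
    then show ?thesis using assms by (rule group_index_works(1))
  qed (simp add: group_index_def)
  ultimately show ?thesis
    by (auto simp: measurable_count_space_eq2_countable)
qed

lemma measurable_group_sample:
  assumes "1 \<le> j" "\<And>i. 1 \<le> i \<Longrightarrow> X i \<in> measurable P N"
  shows "group_sample Ss X s j \<in> measurable P N"
  unfolding group_sample_def[abs_def]
  by (rule measurable_compose_countable'[OF _ measurable_group_index]) (use assms in auto)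

lemma measurable_group_sample_Ys [measurable]:
  "1 \<le> j \<Longrightarrow> group_sample Ss Ys s j \<in> measurable P M"
  by (rule measurable_group_sample[OF _ measurable_Ys])

section \<open>Factorisation over finitely many units\<close>

lemma prob_path:
  assumes t: "\<And>i. i \<in> {1..n} \<Longrightarrow> t i \<in> G" and C: "\<And>i. i \<in> {1..n} \<Longrightarrow> C i \<in> sets M"
  shows "\<P>(\<omega> in P. \<forall>i\<in>{1..n}. Ss i \<omega> = t i \<and> Ys i \<omega> \<in> C i) =
    (\<Prod>i=1..n. \<P>(\<omega> in P. Ss i \<omega> = t i) * measure (Q (t i)) (C i))"
\<comment> \<open>\<open>indep_varsD\<close> asks for a nonempty index set, so the empty path is
  treated apart.\<close>
proof (cases "n = 0")
  case True
  then show ?thesis by (simp add: prob_space)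
next
  case False
  let ?X = "\<lambda>i \<omega>. (Ys i \<omega>, Ss i \<omega>)"
  have "{\<omega> \<in> space P. \<forall>i\<in>{1..n}. Ss i \<omega> = t i \<and> Ys i \<omega> \<in> C i} =
      (\<Inter>i\<in>{1..n}. ?X i -` (C i \<times> {t i}) \<inter> space P)"
    using False by auto
  also have "prob \<dots> = (\<Prod>i=1..n. prob (?X i -` (C i \<times> {t i}) \<inter> space P))"
    using False t C by (intro indep_varsD[OF indep]) auto
  also have "\<dots> = (\<Prod>i=1..n. \<P>(\<omega> in P. Ss i \<omega> = t i \<and> Ys i \<omega> \<in> C i))"
    by (intro prod.cong refl arg_cong[where f = prob]) auto
  also have "\<dots> = (\<Prod>i=1..n. \<P>(\<omega> in P. Ss i \<omega> = t i) * measure (Q (t i)) (C i))"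
    using t C by (intro prod.cong cond) auto
  finally show ?thesis .
qed

lemma measure_Q_space: "s \<in> G \<Longrightarrow> measure (Q s) (space M) = 1"
  using prob_space.prob_space[OF prob_space_Q] sets_eq_imp_space_eq[OF sets_Q] by simp

text \<open>Factors with index beyond \<open>m\<close> equal 1, so the product does not depend on
  the actual count \<open>c\<close>.\<close>

lemma prod_measure_Q_truncate:
  fixes m c :: nat
  assumes "s \<in> G" "m \<le> c" "\<And>j. m < j \<Longrightarrow> B j = space M"
  shows "(\<Prod>j=1..c. measure (Q s) (B j)) = (\<Prod>j=1..m. measure (Q s) (B j))"
  using assms by (intro prod.mono_neutral_right) (auto simp: measure_Q_space)

text \<open>The event splits according to the groups \<open>t\<close> of the first \<open>n\<close>
  units, on which alone \<open>R\<close> depends. For fixed \<open>t\<close> the labels are fixed,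
  and \<open>prob_path\<close> with \<open>prod_label_count\<close> gives a product over labels. As
  \<open>R\<close> forces at least \<open>m\<close> members in each group, truncation at
  \<open>m\<close> makes this product the same for all \<open>t\<close>, and it leaves the
  sum.\<close>

lemma prob_groups_and_labelled:
  assumes R: "\<And>t. R (restrict t {1..n}) \<longleftrightarrow> R t"
    and Rm: "\<And>t s. R t \<Longrightarrow> s \<in> G \<Longrightarrow> m \<le> label_count s n t"
    and B: "\<And>s j. B s j \<in> sets M" and Bm: "\<And>s j. m < j \<Longrightarrow> B s j = space M"
  shows "\<P>(\<omega> in P. R (\<lambda>i. Ss i \<omega>) \<and>
        (\<forall>i\<in>{1..n}. Ys i \<omega> \<in> B (Ss i \<omega>) (group_count Ss (Ss i \<omega>) i \<omega>))) =
    (\<Sum>t\<in>{t \<in> {1..n} \<rightarrow>\<^sub>E G. R t}. \<Prod>i=1..n. \<P>(\<omega> in P. Ss i \<omega> = t i)) *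
    (\<Prod>s\<in>G. \<Prod>j=1..m. measure (Q s) (B s j))" (is "prob ?E = _")
proof -
  let ?T = "{t \<in> {1..n} \<rightarrow>\<^sub>E G. R t}"
  \<comment> \<open>In \<open>F t\<close> the labels are computed from \<open>t\<close> instead of
    \<open>\<omega>\<close>, so the target sets are deterministic.\<close>
  define F where "F t = {\<omega> \<in> space P. \<forall>i\<in>{1..n}. Ss i \<omega> = t i \<and> Ys i \<omega> \<in> B (t i) (label_count (t i) i t)}" for t
  have fin: "finite ?T"
    by (rule finite_subset[OF _ finite_PiE[of "{1..n}" "\<lambda>_. G"]]) (auto simp: finite_G)
  have "?E = (\<Union>t\<in>?T. F t)"
  proof (rule set_eqI, rule iffI)
    fix \<omega> assume \<omega>: "\<omega> \<in> ?E"
    \<comment> \<open>Cutting off outside \<open>{1..n}\<close> yields an element of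
      \<open>?T\<close>; counts up to \<open>i \<le> n\<close> are unaffected.\<close>
    let ?t = "restrict (\<lambda>i. Ss i \<omega>) {1..n}"
    have "label_count s i ?t = group_count Ss s i \<omega>" if "i \<in> {1..n}" for s i
      unfolding group_count_eq_label_count[of Ss] using that by (intro label_count_cong) auto
    then have "\<omega> \<in> F ?t" using \<omega> by (auto simp: F_def)
    moreover have "?t \<in> ?T" using \<omega> R[of "\<lambda>i. Ss i \<omega>"] Ss_in by auto
    ultimately show "\<omega> \<in> (\<Union>t\<in>?T. F t)" by blast
  next
    fix \<omega> assume "\<omega> \<in> (\<Union>t\<in>?T. F t)"
    then obtain t where t: "R t" "t \<in> {1..n} \<rightarrow>\<^sub>E G" "\<omega> \<in> F t" by auto
    have eq: "Ss i \<omega> = t i" if "i \<in> {1..n}" for i using t(3) that by (auto simp: F_def)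
    have "label_count s i t = group_count Ss s i \<omega>" if "i \<in> {1..n}" for s i
      unfolding group_count_eq_label_count[of Ss] using that eq by (intro label_count_cong) auto
    moreover have "R (\<lambda>i. Ss i \<omega>)"
    proof -
      have "restrict (\<lambda>i. Ss i \<omega>) {1..n} = restrict t {1..n}" using eq by auto
      then show ?thesis using R[of t] R[of "\<lambda>i. Ss i \<omega>"] t(1) by simp
    qed
    ultimately show "\<omega> \<in> ?E" using t(3) by (auto simp: F_def)
  qed
  also have "prob \<dots> = (\<Sum>t\<in>?T. prob (F t))"
  proof (rule finite_measure_finite_Union[OF fin])
    have "F t \<in> events" for t
    proof -
      have "Measurable.pred P (\<lambda>\<omega>. \<forall>i\<in>{1..n}. Ss i \<omega> = t i \<and> Ys i \<omega> \<in> B (t i) (label_count (t i) i t))"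
        using measurable_Ys measurable_Ss_eq B
        by (intro pred_intros_finite pred_intros_logic) (auto intro: pred_sets2)
      then show ?thesis unfolding F_def by measurable
    qed
    then show "F ` ?T \<subseteq> events" by blast
    show "disjoint_family_on F ?T"
    proof (unfold disjoint_family_on_def, intro ballI impI)
      fix t t' assume *: "t \<in> ?T" "t' \<in> ?T" "t \<noteq> t'"
      then obtain i where "i \<in> {1..n}" "t i \<noteq> t' i"
        using PiE_ext[of t "{1..n}" "\<lambda>_. G" t'] by blast
      then show "F t \<inter> F t' = {}" by (auto simp: F_def)
    qed
  qed
  also have "\<dots> = (\<Sum>t\<in>?T. (\<Prod>i=1..n. \<P>(\<omega> in P. Ss i \<omega> = t i)) *
      (\<Prod>s\<in>G. \<Prod>j=1..m. measure (Q s) (B s j)))"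
  proof (intro sum.cong refl)
    fix t assume t: "t \<in> ?T"
    have "prob (F t) = (\<Prod>i=1..n. \<P>(\<omega> in P. Ss i \<omega> = t i)) *
        (\<Prod>i=1..n. measure (Q (t i)) (B (t i) (label_count (t i) i t)))"
      unfolding F_def prod.distrib[symmetric] using t B by (intro prob_path) auto
    also have "(\<Prod>i=1..n. measure (Q (t i)) (B (t i) (label_count (t i) i t))) =
        (\<Prod>s\<in>G. \<Prod>j=1..label_count s n t. measure (Q s) (B s j))"
      using t finite_G by (intro prod_label_count) auto
    also have "\<dots> = (\<Prod>s\<in>G. \<Prod>j=1..m. measure (Q s) (B s j))"
      using t Rm Bm by (intro prod.cong refl prod_measure_Q_truncate) auto
    finally show "prob (F t) = (\<Prod>i=1..n. \<P>(\<omega> in P. Ss i \<omega> = t i)) *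
        (\<Prod>s\<in>G. \<Prod>j=1..m. measure (Q s) (B s j))" .
  qed
  finally show ?thesis by (simp add: sum_distrib_right)
qed

section \<open>From finitely many units to the whole sequence\<close>

text \<open>The events increase with \<open>n\<close>, and by \<open>AE_sampled\<close> their union
  is almost surely all of \<open>X\<close>.\<close>

lemma prob_counts_ge_tendsto:
  assumes [measurable]: "Measurable.pred P X"
  shows "(\<lambda>n. \<P>(\<omega> in P. X \<omega> \<and> (\<forall>s\<in>G. m \<le> group_count Ss s n \<omega>))) \<longlonglongrightarrow> \<P>(\<omega> in P. X \<omega>)"
proof -
  let ?F = "\<lambda>n. {\<omega> \<in> space P. X \<omega> \<and> (\<forall>s\<in>G. m \<le> group_count Ss s n \<omega>)}"
  note [simp] = finite_G
  have cm: "Measurable.pred P (\<lambda>\<omega>. \<forall>s\<in>G. m \<le> group_count Ss s n \<omega>)" for n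
    by (intro pred_intros_finite) auto
  have [measurable]: "?F n \<in> events" for n
    using cm[of n] by measurable
  have "(\<lambda>n. prob (?F n)) \<longlonglongrightarrow> prob (\<Union>n. ?F n)"
  proof (rule finite_Lim_measure_incseq)
    show "incseq ?F"
      by (rule incseq_SucI) (auto simp: trans_le_add1)
  qed auto
  also have "prob (\<Union>n. ?F n) = \<P>(\<omega> in P. X \<omega>)"
  proof (rule measure_eq_AE)
    have "AE \<omega> in P. \<forall>s\<in>G. sampled_forever Ss s \<omega>"
      using AE_sampled by (intro AE_finite_allI) auto
    then show "AE \<omega> in P. \<omega> \<in> (\<Union>n. ?F n) \<longleftrightarrow> \<omega> \<in> {\<omega> \<in> space P. X \<omega>}"
    proof (eventually_elim)
      case (elim \<omega>)
      then have "\<forall>s\<in>G. \<forall>\<^sub>F n in sequentially. m \<le> group_count Ss s n \<omega>"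
        by (auto simp: sampled_forever_def filterlim_at_top)
      \<comment> \<open>Finiteness of \<open>G\<close> gives one \<open>n\<close> for all groups at
        once.\<close>
      then have "\<forall>\<^sub>F n in sequentially. \<forall>s\<in>G. m \<le> group_count Ss s n \<omega>"
        by (simp add: eventually_ball_finite)
      then have "\<exists>n. \<forall>s\<in>G. m \<le> group_count Ss s n \<omega>"
        by (auto simp: eventually_sequentially)
      then show ?case by auto
    qed
  qed measurable
  finally show ?thesis .
qed

text \<open>Both sides state the same constraints, indexed once by labels and once by units, via the
  correspondence between the two.\<close>

lemma all_group_samples_iff:
  assumes "\<omega> \<in> space P" "\<And>s. s \<in> G \<Longrightarrow> sampled_forever Ss s \<omega>"
  shows "(\<forall>s\<in>G. \<forall>j\<ge>1. group_sample Ss Ys s j \<omega> \<in> B s j) \<longleftrightarrow>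
    (\<forall>i\<ge>1. Ys i \<omega> \<in> B (Ss i \<omega>) (group_count Ss (Ss i \<omega>) i \<omega>))"
proof (intro iffI allI ballI impI)
  fix i :: nat
  assume *: "\<forall>s\<in>G. \<forall>j\<ge>1. group_sample Ss Ys s j \<omega> \<in> B s j" "1 \<le> i"
  let ?s = "Ss i \<omega>"
  have "1 \<le> group_count Ss ?s i \<omega>" using group_count_less[of 0 i Ss \<omega> ?s] *(2) by simp
  then have "group_sample Ss Ys ?s (group_count Ss ?s i \<omega>) \<omega> \<in> B ?s (group_count Ss ?s i \<omega>)"
    using * assms Ss_in by auto
  then show "Ys i \<omega> \<in> B ?s (group_count Ss ?s i \<omega>)"
    using * assms Ss_in by (simp add: group_sample_def group_index_group_count)
next
  fix s and j :: nat assume *: "\<forall>i\<ge>1. Ys i \<omega> \<in> B (Ss i \<omega>) (group_count Ss (Ss i \<omega>) i \<omega>)" "s \<in> G" "1 \<le> j"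
  then show "group_sample Ss Ys s j \<omega> \<in> B s j"
    using group_index_works[OF assms(2)[OF \<open>s \<in> G\<close>] \<open>1 \<le> j\<close>] unfolding group_sample_def by metis
qed

text \<open>The target set depends on two discrete random quantities; the count is resolved first
  for a fixed group, then the group.\<close>

lemma measurable_labelled:
  assumes "\<And>s j. B s j \<in> sets M" "1 \<le> i"
  shows "Measurable.pred P (\<lambda>\<omega>. Ys i \<omega> \<in> B (Ss i \<omega>) (group_count Ss (Ss i \<omega>) i \<omega>))"
proof -
  have *: "Measurable.pred P (\<lambda>\<omega>. Ys i \<omega> \<in> B s (group_count Ss s i \<omega>))" for s
  proof (rule measurable_compose_countable[OF _ measurable_group_count])
    show "Measurable.pred P (\<lambda>\<omega>. Ys i \<omega> \<in> B s j)" for j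
      using measurable_Ys[OF assms(2)] assms(1) by (auto intro: pred_sets2)
  qed
  show ?thesis
    by (rule measurable_compose_countable'[OF * measurable_Ss])
      (use assms(2) finite_G in \<open>auto intro: countable_finite\<close>)
qed

text \<open>On the event that each group has at least \<open>m\<close> members among the first
  \<open>k \<ge> n\<close> units, the factorisation over \<open>k\<close> units applies exactly.
  Then \<open>k\<close> tends to infinity.\<close>

lemma prob_groups_and_all_samples:
  assumes R: "\<And>t. R (restrict t {1..n}) \<longleftrightarrow> R t"
    and Rmeas: "Measurable.pred P (\<lambda>\<omega>. R (\<lambda>i. Ss i \<omega>))"
    and B: "\<And>s j. B s j \<in> sets M" and Bm: "\<And>s j. m < j \<Longrightarrow> B s j = space M"
  shows "\<P>(\<omega> in P. R (\<lambda>i. Ss i \<omega>) \<and> (\<forall>s\<in>G. \<forall>j\<ge>1. group_sample Ss Ys s j \<omega> \<in> B s j)) =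
    \<P>(\<omega> in P. R (\<lambda>i. Ss i \<omega>)) * (\<Prod>s\<in>G. \<Prod>j=1..m. measure (Q s) (B s j))"
proof -
  let ?c = "\<Prod>s\<in>G. \<Prod>j=1..m. measure (Q s) (B s j)"
  let ?L = "\<lambda>i \<omega>. Ys i \<omega> \<in> B (Ss i \<omega>) (group_count Ss (Ss i \<omega>) i \<omega>)"
  let ?N = "\<lambda>k \<omega>. \<forall>s\<in>G. m \<le> group_count Ss s k \<omega>"
  have "Measurable.pred P (\<lambda>\<omega>. \<forall>i\<in>{1..}. ?L i \<omega>)"
    using measurable_labelled[OF B] by (intro pred_intros_countable_bounded) auto
  with Rmeas have Lm: "Measurable.pred P (\<lambda>\<omega>. R (\<lambda>i. Ss i \<omega>) \<and> (\<forall>i\<in>{1..}. ?L i \<omega>))"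
    by (rule pred_intros_logic)
  have eq: "\<P>(\<omega> in P. (R (\<lambda>i. Ss i \<omega>) \<and> (\<forall>i\<in>{1..}. ?L i \<omega>)) \<and> ?N k \<omega>) =
      \<P>(\<omega> in P. R (\<lambda>i. Ss i \<omega>) \<and> ?N k \<omega>) * ?c" if k: "n \<le> k" for k
  proof -
    \<comment> \<open>Building the count condition into the path predicate makes the requirement of
      at least \<open>m\<close> members hold by construction.\<close>
    let ?R = "\<lambda>t. R t \<and> (\<forall>s\<in>G. m \<le> label_count s k t)"
    have R': "?R (restrict t {1..k}) \<longleftrightarrow> ?R t" for t
    proof -
      have "R (restrict t {1..k}) \<longleftrightarrow> R (restrict (restrict t {1..k}) {1..n})"
        by (rule R[symmetric])
      also have "restrict (restrict t {1..k}) {1..n} = restrict t {1..n}" using k by auto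
      also have "R (restrict t {1..n}) \<longleftrightarrow> R t" by (rule R)
      finally have "R (restrict t {1..k}) \<longleftrightarrow> R t" .
      moreover have "label_count s k (restrict t {1..k}) = label_count s k t" for s
        by (rule label_count_cong) auto
      ultimately show ?thesis by simp
    qed
    have Rm: "m \<le> label_count s k t" if "?R t" "s \<in> G" for t s using that by blast
    note labelled = prob_groups_and_labelled[where R = ?R and n = k and m = m, OF R' Rm]
    have "{\<omega> \<in> space P. (R (\<lambda>i. Ss i \<omega>) \<and> (\<forall>i\<in>{1..}. ?L i \<omega>)) \<and> ?N k \<omega>} =
      {\<omega> \<in> space P. ?R (\<lambda>i. Ss i \<omega>) \<and> (\<forall>i\<in>{1..k}. ?L i \<omega>)}"
    proof -
      \<comment> \<open>A unit after time \<open>k\<close> has a label number above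
        \<open>m\<close>, where the target set is the whole space.\<close>
      have "?L i \<omega>" if "\<omega> \<in> space P" "?N k \<omega>" "1 \<le> i" "\<not> i \<le> k" for i \<omega>
      proof -
        have "m < group_count Ss (Ss i \<omega>) i \<omega>"
          using group_count_less[of k i Ss \<omega> "Ss i \<omega>"] that Ss_in[of i \<omega>] by fastforce
        then show ?thesis using Bm measurable_space[OF measurable_Ys] that by simp
      qed
      then show ?thesis by (auto simp: group_count_eq_label_count[of Ss _ k])
    qed
    moreover have "{\<omega> \<in> space P. R (\<lambda>i. Ss i \<omega>) \<and> ?N k \<omega>} =
      {\<omega> \<in> space P. ?R (\<lambda>i. Ss i \<omega>) \<and> (\<forall>i\<in>{1..k}. Ys i \<omega> \<in> space M)}"
      using measurable_space[OF measurable_Ys] by (auto simp: group_count_eq_label_count[of Ss _ k])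
    \<comment> \<open>The factorisation is used twice: for \<open>B\<close>, and for whole spaces as
      targets, which identifies the sum over paths as the probability of the group event.\<close>
    ultimately show ?thesis
      using labelled[of B, OF _ _ B Bm] labelled[of "\<lambda>_ _. space M"]
      by (simp add: measure_Q_space)
  qed
  have "(\<lambda>k. \<P>(\<omega> in P. (R (\<lambda>i. Ss i \<omega>) \<and> (\<forall>i\<in>{1..}. ?L i \<omega>)) \<and> ?N k \<omega>)) \<longlonglongrightarrow>
      \<P>(\<omega> in P. R (\<lambda>i. Ss i \<omega>) \<and> (\<forall>i\<in>{1..}. ?L i \<omega>))"
    by (rule prob_counts_ge_tendsto[OF Lm])
  moreover have "(\<lambda>k. \<P>(\<omega> in P. (R (\<lambda>i. Ss i \<omega>) \<and> (\<forall>i\<in>{1..}. ?L i \<omega>)) \<and> ?N k \<omega>)) \<longlonglongrightarrow>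
      \<P>(\<omega> in P. R (\<lambda>i. Ss i \<omega>)) * ?c"
  proof (rule Lim_transform_eventually)
    show "(\<lambda>k. \<P>(\<omega> in P. R (\<lambda>i. Ss i \<omega>) \<and> ?N k \<omega>) * ?c) \<longlonglongrightarrow> \<P>(\<omega> in P. R (\<lambda>i. Ss i \<omega>)) * ?c"
      by (intro tendsto_mult_right prob_counts_ge_tendsto Rmeas)
    show "\<forall>\<^sub>F k in sequentially. \<P>(\<omega> in P. R (\<lambda>i. Ss i \<omega>) \<and> ?N k \<omega>) * ?c =
        \<P>(\<omega> in P. (R (\<lambda>i. Ss i \<omega>) \<and> (\<forall>i\<in>{1..}. ?L i \<omega>)) \<and> ?N k \<omega>)"
      by (rule eventually_sequentiallyI[of n]) (rule eq[symmetric])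
  qed
  ultimately have "\<P>(\<omega> in P. R (\<lambda>i. Ss i \<omega>) \<and> (\<forall>i\<in>{1..}. ?L i \<omega>)) =
      \<P>(\<omega> in P. R (\<lambda>i. Ss i \<omega>)) * ?c"
    by (rule LIMSEQ_unique)
  moreover have "\<P>(\<omega> in P. R (\<lambda>i. Ss i \<omega>) \<and> (\<forall>s\<in>G. \<forall>j\<ge>1. group_sample Ss Ys s j \<omega> \<in> B s j)) =
      \<P>(\<omega> in P. R (\<lambda>i. Ss i \<omega>) \<and> (\<forall>i\<in>{1..}. ?L i \<omega>))"
  proof (rule measure_eq_AE)
    have "AE \<omega> in P. \<forall>s\<in>G. sampled_forever Ss s \<omega>"
      using AE_sampled finite_G by (intro AE_finite_allI) auto
    then show "AE \<omega> in P.
      \<omega> \<in> {\<omega> \<in> space P. R (\<lambda>i. Ss i \<omega>) \<and> (\<forall>s\<in>G. \<forall>j\<ge>1. group_sample Ss Ys s j \<omega> \<in> B s j)} \<longleftrightarrow>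
      \<omega> \<in> {\<omega> \<in> space P. R (\<lambda>i. Ss i \<omega>) \<and> (\<forall>i\<in>{1..}. ?L i \<omega>)}"
      by eventually_elim (use all_group_samples_iff[of _ B] in auto)
    have "Measurable.pred P (\<lambda>\<omega>. \<forall>s\<in>G. \<forall>j\<in>{1..}. group_sample Ss Ys s j \<omega> \<in> B s j)"
      using measurable_group_sample_Ys B finite_G
      by (intro pred_intros_finite pred_intros_countable_bounded) (auto intro!: pred_sets2)
    then have "Measurable.pred P (\<lambda>\<omega>. R (\<lambda>i. Ss i \<omega>) \<and> (\<forall>s\<in>G. \<forall>j\<ge>1. group_sample Ss Ys s j \<omega> \<in> B s j))"
      unfolding Ball_def atLeast_iff by (rule pred_intros_logic(3)[OF Rmeas])
    then show "{\<omega> \<in> space P. R (\<lambda>i. Ss i \<omega>) \<and> (\<forall>s\<in>G. \<forall>j\<ge>1. group_sample Ss Ys s j \<omega> \<in> B s j)} \<in> events"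
      by measurable
    show "{\<omega> \<in> space P. R (\<lambda>i. Ss i \<omega>) \<and> (\<forall>i\<in>{1..}. ?L i \<omega>)} \<in> events"
      using Lm by measurable
  qed
  ultimately show ?thesis by simp
qed

text \<open>Labels outside \<open>I\<close> are padded with \<open>space M\<close>; they constrain
  nothing and contribute factors 1.\<close>

lemma prob_groups_and_samples:
  assumes R: "\<And>t. R (restrict t {1..n}) \<longleftrightarrow> R t"
    and Rmeas: "Measurable.pred P (\<lambda>\<omega>. R (\<lambda>i. Ss i \<omega>))"
    and I: "finite I" "I \<subseteq> G \<times> {1..}" and B: "\<And>s j. (s, j) \<in> I \<Longrightarrow> B s j \<in> sets M"
  shows "\<P>(\<omega> in P. R (\<lambda>i. Ss i \<omega>) \<and> (\<forall>(s, j)\<in>I. group_sample Ss Ys s j \<omega> \<in> B s j)) =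
    \<P>(\<omega> in P. R (\<lambda>i. Ss i \<omega>)) * (\<Prod>(s, j)\<in>I. measure (Q s) (B s j))"
proof -
  define B' where "B' s j = (if (s, j) \<in> I then B s j else space M)" for s j
  obtain m where m: "\<And>s j. (s, j) \<in> I \<Longrightarrow> j \<le> m"
    using finite_imageI[OF I(1), of snd] unfolding finite_nat_set_iff_bounded_le by force
  have "{\<omega> \<in> space P. R (\<lambda>i. Ss i \<omega>) \<and> (\<forall>(s, j)\<in>I. group_sample Ss Ys s j \<omega> \<in> B s j)} =
    {\<omega> \<in> space P. R (\<lambda>i. Ss i \<omega>) \<and> (\<forall>s\<in>G. \<forall>j\<ge>1. group_sample Ss Ys s j \<omega> \<in> B' s j)}"
    using I(2) measurable_space[OF measurable_group_sample_Ys] by (fastforce simp: B'_def)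
  also have "prob \<dots> = \<P>(\<omega> in P. R (\<lambda>i. Ss i \<omega>)) * (\<Prod>s\<in>G. \<Prod>j=1..m. measure (Q s) (B' s j))"
    using m B by (intro prob_groups_and_all_samples[OF R Rmeas]) (force simp: B'_def)+
  also have "(\<Prod>s\<in>G. \<Prod>j=1..m. measure (Q s) (B' s j)) =
      (\<Prod>(s, j)\<in>G \<times> {1..m}. measure (Q s) (B' s j))"
    by (simp add: prod.cartesian_product)
  also have "\<dots> = (\<Prod>(s, j)\<in>I. measure (Q s) (B' s j))"
    using I m finite_G by (intro prod.mono_neutral_right) (auto simp: B'_def measure_Q_space)
  also have "\<dots> = (\<Prod>(s, j)\<in>I. measure (Q s) (B s j))"
    by (intro prod.cong) (auto simp: B'_def)
  finally show ?thesis .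
qed

lemma prob_samples:
  assumes "finite I" "I \<subseteq> G \<times> {1..}" "\<And>s j. (s, j) \<in> I \<Longrightarrow> B s j \<in> sets M"
  shows "\<P>(\<omega> in P. \<forall>(s, j)\<in>I. group_sample Ss Ys s j \<omega> \<in> B s j) =
    (\<Prod>(s, j)\<in>I. measure (Q s) (B s j))"
  using prob_groups_and_samples[of "\<lambda>_. True" _ I B] assms by (simp add: prob_space)

lemma prob_group_sample:
  assumes "s \<in> G" "1 \<le> j" "C \<in> sets M"
  shows "prob (group_sample Ss Ys s j -` C \<inter> space P) = measure (Q s) C"
  using prob_samples[of "{(s, j)}" "\<lambda>_ _. C"] assms
  by (simp add: vimage_def Int_def conj_commute)

lemma distr_group_sample:
  assumes "s \<in> G" "1 \<le> j"
  shows "distr P M (group_sample Ss Ys s j) = Q s"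
proof (rule measure_eqI)
  show "sets (distr P M (group_sample Ss Ys s j)) = sets (Q s)"
    using sets_Q assms by simp
  fix C assume "C \<in> sets (distr P M (group_sample Ss Ys s j))"
  then have C: "C \<in> sets M" by simp
  interpret Qs: prob_space "Q s" using assms by (intro prob_space_Q)
  show "emeasure (distr P M (group_sample Ss Ys s j)) C = emeasure (Q s) C"
    using assms C prob_group_sample
    by (simp add: emeasure_distr measurable_group_sample_Ys emeasure_eq_measure Qs.emeasure_eq_measure)
qed

section \<open>Independence statements\<close>

text \<open>Index \<open>0\<close> carries the count, which is a function of the first
  \<open>n\<close> groups, so an event about it can serve as \<open>R\<close> in
  \<open>prob_groups_and_samples\<close>.\<close>

lemma indep_count_samples:
  assumes s: "s \<in> G"
  shows "indep_sets
    (\<lambda>j. if j = 0 then preimage_events P (count_space UNIV) (group_count Ss s n)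
         else preimage_events P M (group_sample Ss Ys s j)) UNIV"
    (is "indep_sets ?F _")
proof (rule indep_setsI)
  show "?F j \<subseteq> events" for j
    using measurable_group_sample_Ys[of j] measurable_group_count
    by (auto simp: preimage_events_def intro: measurable_sets)
  fix A J assume J: "J \<subseteq> UNIV" "finite J" "J \<noteq> {}" and A: "\<forall>j\<in>J. A j \<in> ?F j"
  \<comment> \<open>If \<open>0\<close> is not in \<open>J\<close>, the choice
    \<open>K = UNIV\<close> makes the condition on the count vacuous and its factor 1.\<close>
  obtain K where K: "0 \<in> J \<Longrightarrow> A 0 = group_count Ss s n -` K \<inter> space P"
    and K_UNIV: "0 \<notin> J \<Longrightarrow> K = UNIV"
  proof (cases "0 \<in> J")
    case True
    then obtain K where "A 0 = group_count Ss s n -` K \<inter> space P"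
      using bspec[OF A True] by (auto simp: preimage_events_def)
    then show ?thesis using that[of K] True by blast
  next
    case False
    then show ?thesis using that[of UNIV] by blast
  qed
  have "\<forall>j\<in>J - {0}. \<exists>B\<in>sets M. A j = group_sample Ss Ys s j -` B \<inter> space P"
  proof
    fix j assume "j \<in> J - {0}"
    then have "A j \<in> preimage_events P M (group_sample Ss Ys s j)" using bspec[OF A, of j] by simp
    then show "\<exists>B\<in>sets M. A j = group_sample Ss Ys s j -` B \<inter> space P"
      unfolding preimage_events_def by blast
  qed
  then obtain B where B: "\<And>j. j \<in> J - {0} \<Longrightarrow> B j \<in> sets M"
    "\<And>j. j \<in> J - {0} \<Longrightarrow> A j = group_sample Ss Ys s j -` B j \<inter> space P"
    by metis
  let ?R = "\<lambda>t. label_count s n t \<in> K" and ?I = "{s} \<times> (J - {0})"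
  have R: "?R (\<lambda>i. Ss i \<omega>) \<longleftrightarrow> group_count Ss s n \<omega> \<in> K" for \<omega>
    by (simp add: group_count_eq_label_count[of Ss])
  have "\<omega> \<in> (\<Inter>j\<in>J. A j) \<longleftrightarrow> \<omega> \<in> space P \<and> ?R (\<lambda>i. Ss i \<omega>) \<and>
      (\<forall>(s', j)\<in>?I. group_sample Ss Ys s' j \<omega> \<in> B j)" for \<omega>
  proof -
    have "\<omega> \<in> (\<Inter>j\<in>J. A j) \<longleftrightarrow> (0 \<in> J \<longrightarrow> \<omega> \<in> A 0) \<and> (\<forall>j\<in>J - {0}. \<omega> \<in> A j)"
      by (auto; metis)
    also have "\<dots> \<longleftrightarrow> (0 \<in> J \<longrightarrow> \<omega> \<in> space P) \<and> ?R (\<lambda>i. Ss i \<omega>) \<and>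
        (\<forall>j\<in>J - {0}. \<omega> \<in> space P \<and> group_sample Ss Ys s j \<omega> \<in> B j)"
      using K K_UNIV B(2) by (auto simp: R)
    also have "\<dots> \<longleftrightarrow> \<omega> \<in> space P \<and> ?R (\<lambda>i. Ss i \<omega>) \<and>
      (\<forall>(s', j)\<in>?I. group_sample Ss Ys s' j \<omega> \<in> B j)"
      \<comment> \<open>Since \<open>J\<close> is nonempty, some \<open>A j\<close> confines
        \<open>\<omega>\<close> to \<open>space P\<close>.\<close>
      using J(3) by auto
    finally show ?thesis .
  qed
  then have "(\<Inter>j\<in>J. A j) = {\<omega> \<in> space P. ?R (\<lambda>i. Ss i \<omega>) \<and>
      (\<forall>(s', j)\<in>?I. group_sample Ss Ys s' j \<omega> \<in> B j)}" by blast
  also have "prob \<dots> = \<P>(\<omega> in P. ?R (\<lambda>i. Ss i \<omega>)) * (\<Prod>(s', j)\<in>?I. measure (Q s') (B j))"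
  proof (rule prob_groups_and_samples)
    show "?R (restrict t {1..n}) \<longleftrightarrow> ?R t" for t
      using label_count_cong[of n "restrict t {1..n}" t s] by simp
    show "Measurable.pred P (\<lambda>\<omega>. ?R (\<lambda>i. Ss i \<omega>))" unfolding R by measurable
  qed (use J s B(1) in auto)
  also have "(\<Prod>(s', j)\<in>?I. measure (Q s') (B j)) = (\<Prod>j\<in>J - {0}. measure (Q s) (B j))"
    by (simp add: prod.cartesian_product[symmetric])
  also have "\<dots> = (\<Prod>j\<in>J - {0}. prob (A j))"
    using B s by (intro prod.cong) (auto simp: prob_group_sample)
  also have "\<P>(\<omega> in P. ?R (\<lambda>i. Ss i \<omega>)) = (if 0 \<in> J then prob (A 0) else 1)"
    unfolding R using K K_UNIV by (auto simp: prob_space vimage_def Int_def conj_commute)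
  also have "\<dots> * (\<Prod>j\<in>J - {0}. prob (A j)) = (\<Prod>j\<in>J. prob (A j))"
    using J(2) by (simp add: prod.remove)
  finally show "prob (\<Inter>j\<in>J. A j) = (\<Prod>j\<in>J. prob (A j))" .
qed

lemma indep_samples:
  "indep_vars (\<lambda>_. M) (\<lambda>(s, j). group_sample Ss Ys s j) (G \<times> {1..})"
  unfolding indep_vars_def2
proof (intro conjI ballI)
  fix p assume "p \<in> G \<times> {1::nat..}"
  then show "random_variable M (case p of (s, j) \<Rightarrow> group_sample Ss Ys s j)"
    using measurable_group_sample_Ys by auto
next
  let ?X = "\<lambda>(s, j). group_sample Ss Ys s j"
  show "indep_sets (\<lambda>i. {?X i -` A \<inter> space P |A. A \<in> sets M}) (G \<times> {1..})"
  proof (rule indep_setsI)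
    fix p assume "p \<in> G \<times> {1::nat..}"
    then show "{?X p -` A \<inter> space P |A. A \<in> sets M} \<subseteq> events"
      using measurable_group_sample_Ys by (auto intro: measurable_sets)
  next
    fix A I assume I: "I \<subseteq> G \<times> {1::nat..}" "finite I" "I \<noteq> {}"
      and "\<forall>p\<in>I. A p \<in> {?X p -` A \<inter> space P |A. A \<in> sets M}"
    then have "\<forall>p\<in>I. \<exists>B\<in>sets M. A p = ?X p -` B \<inter> space P" by blast
    then obtain B where B: "\<And>p. p \<in> I \<Longrightarrow> B p \<in> sets M" "\<And>p. p \<in> I \<Longrightarrow> A p = ?X p -` B p \<inter> space P"
      by metis
    have "(\<Inter>p\<in>I. A p) = {\<omega> \<in> space P. \<forall>(s, j)\<in>I. group_sample Ss Ys s j \<omega> \<in> B (s, j)}"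
      using I(3) B(2) by fastforce
    also have "prob \<dots> = (\<Prod>(s, j)\<in>I. measure (Q s) (B (s, j)))"
      using I B(1) by (intro prob_samples) auto
    also have "\<dots> = (\<Prod>p\<in>I. prob (A p))"
      using I(1) B by (intro prod.cong) (auto simp: prob_group_sample)
    finally show "prob (\<Inter>p\<in>I. A p) = (\<Prod>p\<in>I. prob (A p))" .
  qed
qed

text \<open>The vectors use the disjoint blocks \<open>{s} \<times> {1..m s}\<close> of the
  independent family in \<open>indep_samples\<close>; a measurable reindexing then drops
  \<open>s\<close> from the coordinates.\<close>

lemma indep_sample_vectors:
  "indep_vars (\<lambda>s. PiM {1..m s} (\<lambda>_. M)) (\<lambda>s \<omega>. \<lambda>j\<in>{1..m s}. group_sample Ss Ys s j \<omega>) G"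
proof -
  let ?K = "\<lambda>s. {s} \<times> {1..m s}"
  have "indep_vars (\<lambda>s. PiM (?K s) (\<lambda>_. M))
      (\<lambda>s \<omega>. \<lambda>p\<in>?K s. (case p of (s, j) \<Rightarrow> group_sample Ss Ys s j) \<omega>) G"
    by (rule indep_vars_restrict[OF indep_samples]) (auto simp: disjoint_family_on_def)
  then have "indep_vars (\<lambda>s. PiM {1..m s} (\<lambda>_. M)) (\<lambda>s \<omega>. (\<lambda>f. \<lambda>j\<in>{1..m s}. f (s, j))
      (\<lambda>p\<in>?K s. (case p of (s, j) \<Rightarrow> group_sample Ss Ys s j) \<omega>)) G"
    by (rule indep_vars_compose2)
      (rule measurable_restrict, rule measurable_component_singleton, simp)
  moreover have "(\<lambda>f. \<lambda>j\<in>{1..m s}. f (s, j)) (\<lambda>p\<in>?K s. (case p of (s, j) \<Rightarrow> group_sample Ss Ys s j) \<omega>) =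
      (\<lambda>j\<in>{1..m s}. group_sample Ss Ys s j \<omega>)" for s \<omega>
    by auto
  ultimately show ?thesis by simp
qed

end

section \<open>Verification of the setting from the hypotheses\<close>

theorem proposition2p1:
  fixes P :: "'a measure" and M :: "'b measure" and \<xi> :: nat
    and Y :: "'a \<Rightarrow> 'b" and S :: "'a \<Rightarrow> nat"
    and Ys :: "nat \<Rightarrow> 'a \<Rightarrow> 'b" and Ss :: "nat \<Rightarrow> 'a \<Rightarrow> nat"
  defines "\<Xi> \<equiv> {1..\<xi>}"
  assumes "prob_space P"
    and "1 \<le> \<xi>"
    and "(\<lambda>\<omega>. (Y \<omega>, S \<omega>)) \<in> measurable P (M \<Otimes>\<^sub>M count_space \<Xi>)"
    and "\<And>i. 1 \<le> i \<Longrightarrow> (\<lambda>\<omega>. (Ys i \<omega>, Ss i \<omega>)) \<in> measurable P (M \<Otimes>\<^sub>M count_space \<Xi>)"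
    and "prob_space.indep_vars P (\<lambda>i. M \<Otimes>\<^sub>M count_space \<Xi>) (\<lambda>i \<omega>. (Ys i \<omega>, Ss i \<omega>)) {1..}"
    and "\<And>i s. 1 \<le> i \<Longrightarrow> s \<in> \<Xi> \<Longrightarrow>
           \<P>(\<omega> in P. Ss i \<omega> = s) * \<P>(\<omega> in P. S \<omega> = s) > 0 \<Longrightarrow>
           cond_distr P {\<omega> \<in> space P. Ss i \<omega> = s} M (Ys i) =
           cond_distr P {\<omega> \<in> space P. S \<omega> = s} M Y"
    and "\<And>s. s \<in> \<Xi> \<Longrightarrow>
           AE \<omega> in P. filterlim (\<lambda>n. group_count Ss s n \<omega>) at_top sequentially"
    and "\<And>s. s \<in> \<Xi> \<Longrightarrow> \<P>(\<omega> in P. S \<omega> = s) > 0"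
  shows
    "(\<forall>s\<in>\<Xi>. \<forall>j\<ge>1.
        group_index Ss s j \<in> measurable P (count_space {1..}) \<and>
        group_sample Ss Ys s j \<in> measurable P M \<and>
        group_sample Ss Ss s j \<in> measurable P (count_space \<Xi>))
     \<and>
     (\<forall>s\<in>\<Xi>. \<forall>n\<ge>1.
        group_count Ss s n \<in> measurable P (count_space UNIV) \<and>
        prob_space.indep_sets P
          (\<lambda>j. if j = 0 then preimage_events P (count_space UNIV) (group_count Ss s n)
               else preimage_events P M (group_sample Ss Ys s j)) (UNIV :: nat set) \<and>
        (\<forall>j\<ge>1. distr P M (group_sample Ss Ys s j) =
                 cond_distr P {\<omega> \<in> space P. S \<omega> = s} M Y))
     \<and>
     (\<forall>m :: nat \<Rightarrow> nat. (\<forall>s\<in>\<Xi>. 1 \<le> m s) \<longrightarrow>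
        prob_space.indep_vars P
          (\<lambda>s. PiM {1..m s} (\<lambda>_. M))
          (\<lambda>s \<omega>. \<lambda>j\<in>{1..m s}. group_sample Ss Ys s j \<omega>) \<Xi>)"
proof -
  interpret prob_space P by fact
  note pair = assms(4) and cd = assms(7) and pos = assms(9)
  define Q where "Q s = cond_distr P {\<omega> \<in> space P. S \<omega> = s} M Y" for s
  have Y: "Y \<in> measurable P M"
    using measurable_compose[OF pair measurable_fst] by simp
  have Ys: "Ys i \<in> measurable P M" if "1 \<le> i" for i
    using measurable_compose[OF assms(5)[OF that] measurable_fst] by simp
  have Ss: "Measurable.pred P (\<lambda>\<omega>. Ss i \<omega> = s)" if "1 \<le> i" for i s
  proof -
    have "Ss i \<in> measurable P (count_space \<Xi>)"
      using measurable_compose[OF assms(5)[OF that] measurable_snd] by simp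
    then show ?thesis by (rule measurable_compose) simp_all
  qed
  interpret group_sampling P M \<Xi> Q Ys Ss
  proof (rule group_sampling.intro[OF prob_space_axioms group_sampling_axioms.intro])
    show "finite \<Xi>" by (simp add: \<Xi>_def)
    show "indep_vars (\<lambda>i. M \<Otimes>\<^sub>M count_space \<Xi>) (\<lambda>i \<omega>. (Ys i \<omega>, Ss i \<omega>)) {1..}" by fact
    show "AE \<omega> in P. sampled_forever Ss s \<omega>" if "s \<in> \<Xi>" for s
      unfolding sampled_forever_def by (rule assms(8)[OF that])
    show "sets (Q s) = sets M" for s
      by (simp add: Q_def cond_distr_def)
    show "prob_space (Q s)" if "s \<in> \<Xi>" for s
    proof -
      have "prob_space (uniform_measure P {\<omega> \<in> space P. S \<omega> = s})"
        using pos[OF that] by (intro prob_space_uniform_measure) (auto simp: emeasure_eq_measure)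
      then show ?thesis
        unfolding Q_def cond_distr_def using Y by (intro prob_space.prob_space_distr) auto
    qed
    fix i s C assume i: "1 \<le> (i::nat)" and s: "s \<in> \<Xi>" and C: "C \<in> sets M"
    let ?E = "{\<omega> \<in> space P. Ss i \<omega> = s}"
    have E: "?E \<in> events" using Ss[OF i] by measurable
    have EC: "{\<omega> \<in> space P. Ss i \<omega> = s \<and> Ys i \<omega> \<in> C} = ?E \<inter> (Ys i -` C \<inter> space P)" by auto
    have YC: "Ys i -` C \<inter> space P \<in> events" using Ys[OF i] C by (rule measurable_sets)
    show "\<P>(\<omega> in P. Ss i \<omega> = s \<and> Ys i \<omega> \<in> C) = prob ?E * measure (Q s) C"
    \<comment> \<open>If \<open>?E\<close> is null, both sides vanish. Otherwise the equality of
      conditional laws applies, and multiplying by \<open>prob ?E\<close> gives the product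
      form.\<close>
    proof (cases "prob ?E = 0")
      case True
      have "prob (?E \<inter> (Ys i -` C \<inter> space P)) \<le> prob ?E"
        using E by (intro finite_measure_mono) auto
      then show ?thesis using True by (simp add: EC measure_le_0_iff)
    next
      case False
      then have "prob ?E > 0" by (simp add: zero_less_measure_iff)
      then have "Q s = cond_distr P ?E M (Ys i)"
        unfolding Q_def using cd[OF i s] pos[OF s] by simp
      then have "measure (Q s) C = measure (uniform_measure P ?E) (Ys i -` C \<inter> space P)"
        unfolding cond_distr_def using Ys[OF i] C by (simp add: measure_distr)
      also have "\<dots> = prob (?E \<inter> (Ys i -` C \<inter> space P)) / prob ?E"
        using E YC False by (intro measure_uniform_measure) (auto simp: emeasure_eq_measure)
      finally show ?thesis using False by (simp add: EC)
    qed
  qed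
  show ?thesis
    using indep_sample_vectors
    by (intro conjI ballI allI impI measurable_group_index measurable_group_sample measurable_Ss
        measurable_Ys measurable_group_count indep_count_samples
        distr_group_sample[unfolded Q_def]) assumption+
qed

end
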